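(* Let $d, N \in \mathbb{N}$. Suppose that $\sigma: \mathbb{R} \to \mathbb{R}$ is a continuous and non-polynomial function, $\mathbf{K} \subset \mathbb{R}^d$ is compact, and $u_1, \dots, u_N \in C(\mathbf{K})$. Then for every $\varepsilon > 0$ there exist $p \in \mathbb{N}$, $\zeta_i \in \mathbb{R}$, $w_i \in \mathbb{R}^d$ and $\beta_n^i \in \mathbb{R}$ ($i = 1, \dots, p$, $n = 1, \dots, N$) such that for all $n \in \{1, \dots, N\}$ and all $y \in \mathbf{K}$ $$\Big| u_n(y) - \sum_{i=1}^p \beta_n^i\, \sigma(w_i \cdot y + \zeta_i) \Big| < \varepsilon.$$
   Context: $C(\mathbf{K})$ denotes the space of real-valued continuous functions on $\mathbf{K}$, and $w \cdot y$ the Euclidean inner product on $\mathbb{R}^d$. The parameters $p$, $w_i$, $\zeta_i$ do not depend on $n$ (they are shared by all $N$ functions); only the coefficients $\beta_n^i$ depend on $n$ (the upper index $i$ is an index, not a power). *)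

theory Defs
  imports "HOL-Analysis.Analysis" "HOL-Computational_Algebra.Polynomial"
begin

end

theory Submission
  imports Defs
begin

text \<open>Let \<open>M\<close> be the set of those \<open>f\<close> for which every ridge function \<open>y \<mapsto> f (w \<bullet> y + \<zeta>)\<close> is a uniform
  limit on \<open>K\<close> of networks. It is a linear space, closed under affine substitution and locally
  uniform limits. Let \<open>G\<close> be a \<open>k\<close>-fold antiderivative of \<open>\<sigma>\<close>. The \<open>k\<close>-th forward difference of \<open>G\<close>
  with step \<open>h\<close> is a \<open>k\<close>-fold box average of \<open>\<sigma>\<close> (up to scaling), hence lies in \<open>M\<close>; its \<open>k\<close>-th
  derivative is the \<open>k\<close>-th forward difference of \<open>\<sigma>\<close> itself, and its Taylor expansion puts \<open>x ^ k\<close>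
  into \<open>M\<close> as soon as this difference is nonzero somewhere. If it vanished for all \<open>h > 0\<close>, then
  \<open>\<sigma>\<close> would be a polynomial by Frechet's theorem. So \<open>M\<close> contains all polynomials, hence \<open>exp\<close>,
  and the functions \<open>y \<mapsto> exp (w \<bullet> y)\<close> span a point-separating algebra, to which the
  Stone--Weierstrass theorem applies.\<close>

section \<open>Finite differences and Frechet's theorem\<close>

definition forward_diff :: "real \<Rightarrow> (real \<Rightarrow> real) \<Rightarrow> real \<Rightarrow> real" where
  "forward_diff h f = (\<lambda>x. f (x + h) - f x)"

text \<open>The shift by \<open>h\<close> is the identity plus \<open>forward_diff h\<close>, so its
  \<open>j\<close>-th power expands binomially; the vanishing \<open>k\<close>-th difference cuts
  the expansion off at \<open>k\<close>.\<close>

lemma newton_forward_formula: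
  assumes "\<And>x. (forward_diff h ^^ k) f x = 0"
  shows "f (x + real j * h) = (\<Sum>i<k. real (j choose i) * (forward_diff h ^^ i) f x)"
proof (induction j arbitrary: x)
  case 0
  show ?case
  proof (cases k)
    case 0
    then show ?thesis using assms by simp
  next
    case (Suc k')
    then show ?thesis by (simp add: sum.lessThan_Suc_shift del: sum.lessThan_Suc)
  qed
next
  case (Suc j)
  let ?D = "\<lambda>i. (forward_diff h ^^ i) f"
  have step: "?D i (x + h) = ?D i x + ?D (Suc i) x" for i
    by (simp add: forward_diff_def)
  have "f (x + real (Suc j) * h) = f ((x + h) + real j * h)"
    by (simp add: algebra_simps)
  also have "\<dots> = (\<Sum>i<k. real (j choose i) * ?D i x) + (\<Sum>i<k. real (j choose i) * ?D (Suc i) x)"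
    unfolding Suc.IH step by (simp only: distrib_left sum.distrib)
  also have "\<dots> = (\<Sum>i<k. real (Suc j choose i) * ?D i x)"
  proof (cases k)
    case 0
    then show ?thesis by simp
  next
    case (Suc k')
    \<comment> \<open>The top term is a \<open>k\<close>-th difference, hence zero; dropping it
      aligns the two sums for Pascal's rule.\<close>
    have "(\<Sum>i<k. real (j choose i) * ?D (Suc i) x) = (\<Sum>i<k'. real (j choose i) * ?D (Suc i) x)"
      using assms Suc by simp
    moreover have "(\<Sum>i<k. real (j choose i) * ?D i x)
        = ?D 0 x + (\<Sum>i<k'. real (j choose Suc i) * ?D (Suc i) x)"
      unfolding Suc sum.lessThan_Suc_shift by simp
    moreover have "(\<Sum>i<k. real (Suc j choose i) * ?D i x)
        = ?D 0 x + (\<Sum>i<k'. real (Suc j choose Suc i) * ?D (Suc i) x)"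
      unfolding Suc sum.lessThan_Suc_shift by simp
    ultimately show ?thesis
      by (simp add: sum.distrib distrib_right del: funpow.simps)
  qed
  finally show ?case .
qed

text \<open>In Newton's formula the binomial coefficients are polynomials in \<open>j\<close>, and
  \<open>j\<close> is an affine function of the point \<open>a + j * h\<close>.\<close>

lemma polynomial_on_progression:
  fixes f :: "real \<Rightarrow> real"
  assumes "\<And>x. (forward_diff h ^^ k) f x = 0" and "h \<noteq> 0"
  obtains q :: "real poly" where "\<And>j. f (a + real j * h) = poly q (a + real j * h)"
proof -
  define B :: "nat \<Rightarrow> real poly"
    where "B i = smult (1 / fact i) (\<Prod>l<i. [:- real l, 1:])" for i
  have B: "poly (B i) (real j) = real (j choose i)" for i j
    by (simp add: B_def poly_prod binomial_gbinomial gbinomial_prod_rev atLeast0LessThan)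
  define q where "q = pcompose (\<Sum>i<k. smult ((forward_diff h ^^ i) f a) (B i)) [:- a / h, 1 / h:]"
  have "poly q (a + real j * h) = f (a + real j * h)" for j
  proof -
    have "- a / h + (a + real j * h) / h = real j"
      using \<open>h \<noteq> 0\<close> by (simp add: field_simps)
    then show ?thesis
      unfolding newton_forward_formula[OF assms(1)]
      by (simp add: q_def poly_pcompose poly_sum B mult.commute)
  qed
  then show thesis using that by metis
qed

lemma poly_eq_on_nats:
  fixes p q :: "real poly"
  assumes "\<And>n. poly p (real n) = poly q (real n)"
  shows "p = q"
proof (rule ccontr)
  assume "p \<noteq> q"
  then have "finite {x. poly (p - q) x = 0}"
    by (intro poly_roots_finite) simp
  moreover have "range real \<subseteq> {x. poly (p - q) x = 0}"
    using assms by auto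
  ultimately show False
    using finite_subset infinite_UNIV_nat finite_imageD inj_of_nat by metis
qed

text \<open>On each progression of step $1/m$ the function is a polynomial; two such polynomials agree at
  all natural numbers, so a single one serves at every rational.\<close>

lemma frechet_polynomial:
  fixes f :: "real \<Rightarrow> real"
  assumes cont: "continuous_on UNIV f"
    and diff: "\<And>h x. h > 0 \<Longrightarrow> (forward_diff h ^^ k) f x = 0"
  shows "\<exists>q :: real poly. \<forall>x. f x = poly q x"
proof -
  \<comment> \<open>Starting at the integer \<open>- b\<close> with step \<open>1 / m\<close>, the
    progression passes through all natural numbers, and through any given rational once
    \<open>b\<close> and \<open>m\<close> are suitable.\<close>
  have prog: "\<exists>q :: real poly. \<forall>j. f (- real b + real j * (1 / real m))
      = poly q (- real b + real j * (1 / real m))" if "m > 0" for b m :: nat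
  proof -
    have h: "1 / real m > 0" using that by simp
    from polynomial_on_progression[OF diff[OF h], of "- real b"] h show ?thesis
      by (metis less_irrefl)
  qed
  obtain p :: "real poly" where p: "\<And>n. f (real n) = poly p (real n)"
    using prog[of 1 0] by auto
  have "f r - poly p r = 0" if rat: "r \<in> \<rat>" for r
  proof -
    obtain a :: int and m :: nat where m: "m > 0" and r: "r = real_of_int a / real m"
      using rat by (metis Rats_cases' of_int_of_nat_eq pos_int_cases)
    \<comment> \<open>Since \<open>r = a / m\<close> is at least \<open>- \<bar>a\<bar>\<close>, it
      is the point of index \<open>a + b * m\<close> of the progression.\<close>
    define b where "b = nat \<bar>a\<bar>"
    obtain q :: "real poly" where q: "\<And>j. f (- real b + real j * (1 / real m))
        = poly q (- real b + real j * (1 / real m))"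
      using prog[OF m] by blast
    have "q = p"
    proof (rule poly_eq_on_nats)
      fix n
      have "real n = - real b + real (m * (b + n)) * (1 / real m)"
        using m by (simp add: field_simps)
      then show "poly q (real n) = poly p (real n)"
        using q p by metis
    qed
    define j where "j = nat (a + int (b * m))"
    have "int b \<le> int (b * m)"
      using m by (metis One_nat_def Suc_leI mult.right_neutral mult_le_mono2 of_nat_mono)
    then have "a + int (b * m) \<ge> 0"
      unfolding b_def by linarith
    then have "int j = a + int (b * m)"
      by (simp add: j_def)
    then have "real j = real_of_int a + real b * real m"
      by (metis of_int_add of_int_of_nat_eq of_nat_mult)
    then have "r = - real b + real j * (1 / real m)"
      using m r by (simp add: field_simps)
    then show ?thesis
      using q \<open>q = p\<close> by simp
  qed
  moreover have "continuous_on (closure \<rat>) (\<lambda>x. f x - poly p x)"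
    unfolding Rats_closure_real by (intro continuous_intros cont)
  ultimately have "f x - poly p x = 0" for x
    using continuous_constant_on_closure[of \<rat> "\<lambda>x. f x - poly p x" 0 x]
    by (simp add: Rats_closure_real)
  then show ?thesis
    by (intro exI[of _ p]) (simp add: algebra_simps)
qed

section \<open>Uniform approximation by networks\<close>

text \<open>Neurons are indexed by their own weight and bias, so two networks merge over the union
  of their index sets, with coefficients extended by zero.\<close>

definition net :: "(real \<Rightarrow> real) \<Rightarrow> ('a::real_inner \<times> real) set \<Rightarrow> ('a \<times> real \<Rightarrow> real) \<Rightarrow> 'a \<Rightarrow> real" where
  "net \<sigma> S \<beta> y = (\<Sum>a\<in>S. \<beta> a * \<sigma> (fst a \<bullet> y + snd a))"

definition approximable :: "(real \<Rightarrow> real) \<Rightarrow> 'a::real_inner set \<Rightarrow> ('a \<Rightarrow> real) \<Rightarrow> bool" where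
  "approximable \<sigma> K g \<longleftrightarrow>
     (\<forall>\<epsilon>>0. \<exists>S \<beta>. finite S \<and> (\<forall>y\<in>K. \<bar>g y - net \<sigma> S \<beta> y\<bar> < \<epsilon>))"

text \<open>Quantifying over all weights and biases reduces the task to functions of one variable
  and builds in stability under dilation and translation.\<close>

definition ridge_approximable :: "(real \<Rightarrow> real) \<Rightarrow> 'a::real_inner set \<Rightarrow> (real \<Rightarrow> real) \<Rightarrow> bool" where
  "ridge_approximable \<sigma> K f \<longleftrightarrow> (\<forall>w \<zeta>. approximable \<sigma> K (\<lambda>y. f (w \<bullet> y + \<zeta>)))"

lemma net_extend:
  assumes "finite T" "S \<subseteq> T"
  shows "net \<sigma> T (\<lambda>a. if a \<in> S then \<beta> a else 0) y = net \<sigma> S \<beta> y"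
  unfolding net_def using assms by (intro sum.mono_neutral_cong_right) auto

lemma approximable_limit:
  assumes "\<And>\<epsilon>. \<epsilon> > 0 \<Longrightarrow> \<exists>f. approximable \<sigma> K f \<and> (\<forall>y\<in>K. \<bar>g y - f y\<bar> < \<epsilon>)"
  shows "approximable \<sigma> K g"
  unfolding approximable_def
proof (intro allI impI)
  fix \<epsilon> :: real assume "\<epsilon> > 0"
  then have e: "\<epsilon> / 2 > 0" by simp
  from assms[OF e] obtain f where f: "approximable \<sigma> K f" "\<forall>y\<in>K. \<bar>g y - f y\<bar> < \<epsilon> / 2"
    by blast
  from f(1) e obtain S \<beta> where S: "finite S" "\<forall>y\<in>K. \<bar>f y - net \<sigma> S \<beta> y\<bar> < \<epsilon> / 2"
    unfolding approximable_def by blast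
  have "\<bar>g y - net \<sigma> S \<beta> y\<bar> < \<epsilon>" if "y \<in> K" for y
    using f(2)[rule_format, OF that] S(2)[rule_format, OF that] by linarith
  with S(1) show "\<exists>S \<beta>. finite S \<and> (\<forall>y\<in>K. \<bar>g y - net \<sigma> S \<beta> y\<bar> < \<epsilon>)"
    by blast
qed

lemma approximable_add:
  assumes "approximable \<sigma> K f" "approximable \<sigma> K g"
  shows "approximable \<sigma> K (\<lambda>y. f y + g y)"
  unfolding approximable_def
proof (intro allI impI)
  fix \<epsilon> :: real assume "\<epsilon> > 0"
  then have e: "\<epsilon> / 2 > 0" by simp
  from assms(1) e obtain S \<beta> where S: "finite S" "\<forall>y\<in>K. \<bar>f y - net \<sigma> S \<beta> y\<bar> < \<epsilon> / 2"
    unfolding approximable_def by blast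
  from assms(2) e obtain T \<gamma> where T: "finite T" "\<forall>y\<in>K. \<bar>g y - net \<sigma> T \<gamma> y\<bar> < \<epsilon> / 2"
    unfolding approximable_def by blast
  let ?\<delta> = "\<lambda>a. (if a \<in> S then \<beta> a else 0) + (if a \<in> T then \<gamma> a else 0)"
  have "net \<sigma> (S \<union> T) ?\<delta> y = net \<sigma> S \<beta> y + net \<sigma> T \<gamma> y" for y
  proof -
    have "net \<sigma> (S \<union> T) ?\<delta> y = net \<sigma> (S \<union> T) (\<lambda>a. if a \<in> S then \<beta> a else 0) y
        + net \<sigma> (S \<union> T) (\<lambda>a. if a \<in> T then \<gamma> a else 0) y"
      unfolding net_def by (simp only: distrib_right sum.distrib)
    then show ?thesis
      using S T by (simp add: net_extend)
  qed
  then have "\<bar>f y + g y - net \<sigma> (S \<union> T) ?\<delta> y\<bar> < \<epsilon>" if "y \<in> K" for y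
    using S(2)[rule_format, OF that] T(2)[rule_format, OF that] by (simp only:)
  with S(1) T(1) show "\<exists>S \<beta>. finite S \<and> (\<forall>y\<in>K. \<bar>f y + g y - net \<sigma> S \<beta> y\<bar> < \<epsilon>)"
    by (intro exI[of _ "S \<union> T"] exI[of _ ?\<delta>]) simp
qed

lemma approximable_cmult:
  assumes "approximable \<sigma> K f"
  shows "approximable \<sigma> K (\<lambda>y. c * f y)"
  unfolding approximable_def
proof (intro allI impI)
  fix \<epsilon> :: real assume \<epsilon>: "\<epsilon> > 0"
  \<comment> \<open>The added 1 covers \<open>c = 0\<close>.\<close>
  then have "\<epsilon> / (\<bar>c\<bar> + 1) > 0" by simp
  with assms obtain S \<beta> where S: "finite S" "\<forall>y\<in>K. \<bar>f y - net \<sigma> S \<beta> y\<bar> < \<epsilon> / (\<bar>c\<bar> + 1)"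
    unfolding approximable_def by blast
  have "\<bar>c * f y - net \<sigma> S (\<lambda>a. c * \<beta> a) y\<bar> < \<epsilon>" if "y \<in> K" for y
  proof -
    have "\<bar>c * f y - net \<sigma> S (\<lambda>a. c * \<beta> a) y\<bar> = \<bar>c\<bar> * \<bar>f y - net \<sigma> S \<beta> y\<bar>"
      unfolding net_def
      by (simp add: sum_distrib_left mult.assoc right_diff_distrib flip: abs_mult)
    also have "\<dots> \<le> (\<bar>c\<bar> + 1) * \<bar>f y - net \<sigma> S \<beta> y\<bar>"
      by (simp add: mult_right_mono)
    also have "\<dots> < \<epsilon>"
      using S(2) that by (simp add: pos_less_divide_eq mult.commute)
    finally show ?thesis .
  qed
  with S(1) show "\<exists>S \<beta>. finite S \<and> (\<forall>y\<in>K. \<bar>c * f y - net \<sigma> S \<beta> y\<bar> < \<epsilon>)"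
    by blast
qed

section \<open>Closure properties of the ridge approximable functions\<close>

lemma ridge_approximable_activation: "ridge_approximable \<sigma> K \<sigma>"
  unfolding ridge_approximable_def approximable_def
proof (intro allI impI)
  fix w :: 'a and \<zeta> \<epsilon> :: real assume "\<epsilon> > 0"
  then show "\<exists>S \<beta>. finite S \<and> (\<forall>y\<in>K. \<bar>\<sigma> (w \<bullet> y + \<zeta>) - net \<sigma> S \<beta> y\<bar> < \<epsilon>)"
    by (intro exI[of _ "{(w, \<zeta>)}"] exI[of _ "\<lambda>_. 1"]) (simp add: net_def)
qed

lemma ridge_approximable_add:
  assumes "ridge_approximable \<sigma> K f" "ridge_approximable \<sigma> K g"
  shows "ridge_approximable \<sigma> K (\<lambda>x. f x + g x)"
  using assms approximable_add unfolding ridge_approximable_def by blast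

lemma ridge_approximable_cmult:
  assumes "ridge_approximable \<sigma> K f"
  shows "ridge_approximable \<sigma> K (\<lambda>x. c * f x)"
  using assms approximable_cmult unfolding ridge_approximable_def by blast

lemma ridge_approximable_diff:
  assumes "ridge_approximable \<sigma> K f" "ridge_approximable \<sigma> K g"
  shows "ridge_approximable \<sigma> K (\<lambda>x. f x - g x)"
  using ridge_approximable_add[OF assms(1) ridge_approximable_cmult[OF assms(2), of "-1"]] by simp

lemma ridge_approximable_sum:
  assumes "ridge_approximable \<sigma> K g" and "\<And>i. i \<in> I \<Longrightarrow> ridge_approximable \<sigma> K (f i)"
  shows "ridge_approximable \<sigma> K (\<lambda>x. \<Sum>i\<in>I. f i x)"
proof -
  \<comment> \<open>A multiple by 0 of \<open>g\<close> provides the value of an empty sum.\<close>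
  have zero: "ridge_approximable \<sigma> K (\<lambda>x. 0)"
    using ridge_approximable_cmult[OF assms(1), of 0] by simp
  show ?thesis
    using assms(2) by (induction I rule: infinite_finite_induct)
      (auto intro: zero ridge_approximable_add)
qed

lemma ridge_approximable_affine:
  assumes "ridge_approximable \<sigma> K f"
  shows "ridge_approximable \<sigma> K (\<lambda>x. f (a * x + b))"
  unfolding ridge_approximable_def
proof (intro allI)
  fix w \<zeta>
  have "approximable \<sigma> K (\<lambda>y. f ((a *\<^sub>R w) \<bullet> y + (a * \<zeta> + b)))"
    using assms unfolding ridge_approximable_def by blast
  then show "approximable \<sigma> K (\<lambda>y. f (a * (w \<bullet> y + \<zeta>) + b))"
    by (simp add: algebra_simps)
qed

text \<open>On a bounded \<open>K\<close> the arguments \<open>w \<bullet> y + \<zeta>\<close> stay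
  in a bounded interval, so locally uniform approximation on the line suffices.\<close>

lemma ridge_approximable_limit:
  fixes K :: "'a::real_inner set"
  assumes "bounded K"
    and lim: "\<And>R \<epsilon>. R > 0 \<Longrightarrow> \<epsilon> > 0 \<Longrightarrow>
      \<exists>g. ridge_approximable \<sigma> K g \<and> (\<forall>x. \<bar>x\<bar> \<le> R \<longrightarrow> \<bar>f x - g x\<bar> < \<epsilon>)"
  shows "ridge_approximable \<sigma> K f"
  unfolding ridge_approximable_def
proof (intro allI approximable_limit)
  fix w :: 'a and \<zeta> \<epsilon> :: real
  assume "\<epsilon> > 0"
  obtain B where B: "B > 0" "\<And>y. y \<in> K \<Longrightarrow> norm y \<le> B"
    using \<open>bounded K\<close> bounded_pos by metis
  define R where "R = norm w * B + \<bar>\<zeta>\<bar> + 1"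
  have "R > 0"
    unfolding R_def using B(1) by (intro add_nonneg_pos) auto
  from lim[OF this \<open>\<epsilon> > 0\<close>] obtain g where g: "ridge_approximable \<sigma> K g"
      "\<And>x. \<bar>x\<bar> \<le> R \<Longrightarrow> \<bar>f x - g x\<bar> < \<epsilon>"
    by blast
  have "\<bar>w \<bullet> y + \<zeta>\<bar> \<le> R" if "y \<in> K" for y
  proof -
    have "\<bar>w \<bullet> y\<bar> \<le> norm w * B"
      using Cauchy_Schwarz_ineq2[of w y] mult_left_mono[OF B(2)[OF that], of "norm w"] by simp
    then show ?thesis unfolding R_def by linarith
  qed
  with g show "\<exists>h. approximable \<sigma> K h \<and> (\<forall>y\<in>K. \<bar>f (w \<bullet> y + \<zeta>) - h y\<bar> < \<epsilon>)"
    unfolding ridge_approximable_def by blast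
qed

text \<open>By the mean value theorem, $F(x+h) - F(x)$ is a locally uniform limit of Riemann sums of
  $F'$ over $[x, x+h]$, which are combinations of translates of $F'$.\<close>

lemma ridge_approximable_forward_diff:
  assumes "bounded K" and f: "ridge_approximable \<sigma> K f" and cont: "continuous_on UNIV f"
    and F: "\<And>x. (F has_real_derivative f x) (at x)" and "h > 0"
  shows "ridge_approximable \<sigma> K (forward_diff h F)"
proof (rule ridge_approximable_limit[OF \<open>bounded K\<close>])
  fix R \<epsilon> :: real assume "R > 0" "\<epsilon> > 0"
  \<comment> \<open>This interval contains \<open>[x, x + h]\<close> for every \<open>x\<close> in
    \<open>[- R, R]\<close>. The tolerance \<open>\<epsilon> / (2 * h)\<close> will add up to
    \<open>\<epsilon> / 2\<close> over the length \<open>h\<close>.\<close>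
  have "uniformly_continuous_on {- R..R + h} f"
    using cont by (intro compact_uniformly_continuous) (auto intro: continuous_on_subset)
  moreover have "\<epsilon> / (2 * h) > 0" using \<open>\<epsilon> > 0\<close> \<open>h > 0\<close> by simp
  ultimately obtain d where d: "d > 0"
    "\<And>s t. s \<in> {- R..R + h} \<Longrightarrow> t \<in> {- R..R + h} \<Longrightarrow> \<bar>t - s\<bar> < d \<Longrightarrow> \<bar>f t - f s\<bar> < \<epsilon> / (2 * h)"
    unfolding uniformly_continuous_on_def dist_real_def by metis
  obtain n :: nat where n: "h / d < real n"
    using reals_Archimedean2 by blast
  with \<open>h > 0\<close> \<open>d > 0\<close> have "n > 0"
    by (metis divide_pos_pos of_nat_0_less_iff order_less_trans)
  define \<delta> where "\<delta> = h / real n"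
  have \<delta>: "\<delta> > 0" "\<delta> < d" "real n * \<delta> = h"
    using n \<open>h > 0\<close> \<open>d > 0\<close> \<open>n > 0\<close> by (auto simp: \<delta>_def field_simps)
  \<comment> \<open>The left Riemann sum; the factor 1 exhibits each translate as an affine
    substitution.\<close>
  define g where "g = (\<lambda>x. \<Sum>i<n. \<delta> * f (1 * x + real i * \<delta>))"
  have "ridge_approximable \<sigma> K g"
    unfolding g_def
    by (intro ridge_approximable_sum[OF f] ridge_approximable_cmult ridge_approximable_affine f)
  moreover have "\<bar>forward_diff h F x - g x\<bar> < \<epsilon>" if x: "\<bar>x\<bar> \<le> R" for x
  proof -
    have cell: "\<bar>F (x + real (Suc i) * \<delta>) - F (x + real i * \<delta>) - \<delta> * f (x + real i * \<delta>)\<bar>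
        \<le> \<delta> * (\<epsilon> / (2 * h))" if "i < n" for i
    proof -
      have lt: "x + real i * \<delta> < x + real (Suc i) * \<delta>"
        using \<delta>(1) by (simp add: algebra_simps)
      obtain z where z: "x + real i * \<delta> < z" "z < x + real (Suc i) * \<delta>"
        "F (x + real (Suc i) * \<delta>) - F (x + real i * \<delta>)
          = (x + real (Suc i) * \<delta> - (x + real i * \<delta>)) * f z"
        using MVT2[OF lt, of F f] F by blast
      have "real (Suc i) * \<delta> \<le> real n * \<delta>" "real i * \<delta> \<ge> 0"
        using that \<delta>(1) by (auto intro!: mult_right_mono simp del: of_nat_Suc)
      then have "- R \<le> x + real i * \<delta>" "x + real (Suc i) * \<delta> \<le> R + h"
        using x \<delta>(3) by linarith+
      moreover have "x + real (Suc i) * \<delta> = (x + real i * \<delta>) + \<delta>"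
        by (simp add: distrib_right)
      ultimately have "\<bar>f z - f (x + real i * \<delta>)\<bar> < \<epsilon> / (2 * h)"
        using z(1,2) \<delta>(2) by (intro d(2)) auto
      moreover have "F (x + real (Suc i) * \<delta>) - F (x + real i * \<delta>) - \<delta> * f (x + real i * \<delta>)
          = \<delta> * (f z - f (x + real i * \<delta>))"
        unfolding z(3) by (simp add: algebra_simps)
      ultimately show ?thesis
        using \<delta>(1) by (simp only: abs_mult abs_of_pos) (intro mult_left_mono, auto)
    qed
    have "forward_diff h F x = (\<Sum>i<n. F (x + real (Suc i) * \<delta>) - F (x + real i * \<delta>))"
      using sum_lessThan_telescope[of "\<lambda>i. F (x + real i * \<delta>)" n] \<delta>(3)
      by (simp add: forward_diff_def)
    then have "forward_diff h F x - g x
        = (\<Sum>i<n. F (x + real (Suc i) * \<delta>) - F (x + real i * \<delta>) - \<delta> * f (x + real i * \<delta>))"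
      by (simp add: g_def sum_subtractf)
    also have "\<bar>\<dots>\<bar> \<le> (\<Sum>i<n. \<delta> * (\<epsilon> / (2 * h)))"
      by (rule order_trans[OF sum_abs sum_mono]) (use cell in auto)
    also have "\<dots> = (real n * \<delta>) * (\<epsilon> / (2 * h))"
      by simp
    also have "\<dots> < \<epsilon>"
      unfolding \<delta>(3) using \<open>h > 0\<close> \<open>\<epsilon> > 0\<close> by simp
    finally show ?thesis .
  qed
  ultimately show "\<exists>g. ridge_approximable \<sigma> K g \<and>
      (\<forall>x. \<bar>x\<bar> \<le> R \<longrightarrow> \<bar>forward_diff h F x - g x\<bar> < \<epsilon>)"
    by blast
qed

text \<open>Once the terms of degree below $j$ of the Taylor expansion of $f(\eta x + \zeta)$ are known to be
  approximable, subtracting them and dividing by $\eta^j$ leaves the term of degree $j$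
  as $\eta \to 0$.\<close>

lemma ridge_approximable_taylor_term:
  assumes "bounded K" and f: "ridge_approximable \<sigma> K (f 0)"
    and deriv: "\<And>i x. i < k \<Longrightarrow> (f i has_real_derivative f (Suc i) x) (at x)"
    and cont: "continuous_on UNIV (f k)" and "j \<le> k"
  shows "ridge_approximable \<sigma> K (\<lambda>x. f j \<zeta> * x ^ j)"
  using \<open>j \<le> k\<close>
proof (induction j rule: less_induct)
  case (less j)
  \<comment> \<open>Each power keeps its Taylor coefficient, which may be zero, so the induction
    never divides by it.\<close>
  have lower: "ridge_approximable \<sigma> K (\<lambda>x. f i \<zeta> * x ^ i)" if "i < j" for i
    using less that by simp
  have "isCont (f j) \<zeta>"
    using less.prems cont deriv DERIV_isCont
    by (metis continuous_on_eq_continuous_at iso_tuple_UNIV_I le_neq_implies_less open_UNIV)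
  show ?case
  proof (rule ridge_approximable_limit[OF \<open>bounded K\<close>])
    fix R \<epsilon> :: real assume "R > 0" "\<epsilon> > 0"
    \<comment> \<open>The division by \<open>R ^ j\<close> absorbs the factor \<open>x ^ j\<close>
      of the error on \<open>[- R, R]\<close>.\<close>
    then have "\<epsilon> / R ^ j > 0" by simp
    with \<open>isCont (f j) \<zeta>\<close> obtain d where d: "d > 0"
      "\<And>t. \<bar>t - \<zeta>\<bar> < d \<Longrightarrow> \<bar>f j t - f j \<zeta>\<bar> < \<epsilon> / R ^ j"
      unfolding continuous_at_eps_delta dist_real_def by metis
    \<comment> \<open>Then \<open>\<eta> * R = d / 2\<close>, which keeps the intermediate point of
      Taylor's formula within \<open>d\<close> of \<open>\<zeta>\<close>.\<close>
    define \<eta> where "\<eta> = d / (2 * R)"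
    have \<eta>: "\<eta> > 0" "\<eta> * R < d"
      using \<open>R > 0\<close> \<open>d > 0\<close> by (auto simp: \<eta>_def)
    define g where "g = (\<lambda>x. (fact j / \<eta> ^ j) *
      (f 0 (\<eta> * x + \<zeta>) - (\<Sum>i<j. (\<eta> ^ i / fact i) * (f i \<zeta> * x ^ i))))"
    have "ridge_approximable \<sigma> K g"
      unfolding g_def
      by (intro ridge_approximable_cmult ridge_approximable_diff ridge_approximable_affine f
          ridge_approximable_sum[OF f] lower) simp
    moreover have "\<bar>f j \<zeta> * x ^ j - g x\<bar> < \<epsilon>" if x: "\<bar>x\<bar> \<le> R" for x
    proof -
      have dv: "\<forall>m t. m < j \<and> \<bar>t\<bar> \<le> \<bar>\<eta> * x\<bar> \<longrightarrow>
          DERIV (\<lambda>t. f m (t + \<zeta>)) t :> f (Suc m) (t + \<zeta>)"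
        using deriv less.prems by (auto intro: DERIV_shift[THEN iffD1])
      obtain t where t: "\<bar>t\<bar> \<le> \<bar>\<eta> * x\<bar>"
        "f 0 (\<eta> * x + \<zeta>) = (\<Sum>m<j. f m (0 + \<zeta>) / fact m * (\<eta> * x) ^ m)
          + f j (t + \<zeta>) / fact j * (\<eta> * x) ^ j"
        using Maclaurin_bi_le[of "\<lambda>m t. f m (t + \<zeta>)" "\<lambda>t. f 0 (t + \<zeta>)" j "\<eta> * x", OF refl dv] by auto
      have gx: "g x = f j (t + \<zeta>) * x ^ j"
        unfolding g_def t(2) using \<eta>(1) by (simp add: power_mult_distrib mult_ac)
      have "\<bar>\<eta> * x\<bar> \<le> \<eta> * R"
        using x \<eta>(1) by (simp add: abs_mult)
      then have "\<bar>f j (t + \<zeta>) - f j \<zeta>\<bar> < \<epsilon> / R ^ j"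
        using t(1) \<eta>(2) by (intro d(2)) simp
      moreover have "\<bar>x\<bar> ^ j \<le> R ^ j"
        using x by (intro power_mono) auto
      ultimately have "\<bar>f j (t + \<zeta>) - f j \<zeta>\<bar> * \<bar>x\<bar> ^ j < \<epsilon>"
        using \<open>R > 0\<close> mult_left_mono[of "\<bar>x\<bar> ^ j" "R ^ j" "\<bar>f j (t + \<zeta>) - f j \<zeta>\<bar>"]
        by (simp add: pos_less_divide_eq)
      moreover have "f j \<zeta> * x ^ j - g x = - ((f j (t + \<zeta>) - f j \<zeta>) * x ^ j)"
        unfolding gx by (simp add: algebra_simps)
      ultimately show ?thesis
        by (simp add: abs_mult power_abs)
    qed
    ultimately show "\<exists>g. ridge_approximable \<sigma> K g \<and>
        (\<forall>x. \<bar>x\<bar> \<le> R \<longrightarrow> \<bar>f j \<zeta> * x ^ j - g x\<bar> < \<epsilon>)"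
      by blast
  qed
qed

section \<open>Iterated antiderivatives, monomials and continuous functions\<close>

lemma continuous_imp_antiderivative:
  fixes f :: "real \<Rightarrow> real"
  assumes "continuous_on UNIV f"
  obtains F where "\<And>x. (F has_real_derivative f x) (at x)"
proof -
  have "\<exists>F. \<forall>x::real. -\<infinity> < ereal x \<longrightarrow> ereal x < \<infinity> \<longrightarrow> (F has_vector_derivative f x) (at x)"
    using assms by (intro einterval_antiderivative) (auto simp: continuous_on_eq_continuous_at)
  then show thesis
    using that by (auto simp: has_real_derivative_iff_has_vector_derivative)
qed

lemma iterated_antiderivatives:
  fixes f :: "real \<Rightarrow> real"
  assumes "continuous_on UNIV f"
  obtains G where "G 0 = f" "\<And>n x. (G (Suc n) has_real_derivative G n x) (at x)"
    "\<And>n. continuous_on UNIV (G n)"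
proof -
  \<comment> \<open>Continuity is part of the invariant because the next antiderivative requires it;
    the clause for \<open>n = 0\<close> fixes the start of the sequence.\<close>
  have "\<exists>G. \<forall>n. (continuous_on UNIV (G n) \<and> (n = 0 \<longrightarrow> G n = f)) \<and>
      (\<forall>x. (G (Suc n) has_real_derivative G n x) (at x))"
  proof (rule dependent_nat_choice)
    show "\<exists>g. continuous_on UNIV g \<and> (0 = (0::nat) \<longrightarrow> g = f)"
      using assms by blast
  next
    fix g :: "real \<Rightarrow> real" and n :: nat
    assume "continuous_on UNIV g \<and> (n = 0 \<longrightarrow> g = f)"
    then obtain F where F: "\<And>x. (F has_real_derivative g x) (at x)"
      using continuous_imp_antiderivative by blast
    then have "continuous_on UNIV F"
      by (meson DERIV_isCont continuous_at_imp_continuous_on)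
    with F show "\<exists>F. (continuous_on UNIV F \<and> (Suc n = 0 \<longrightarrow> F = f)) \<and>
        (\<forall>x. (F has_real_derivative g x) (at x))"
      by blast
  qed
  then show thesis using that by metis
qed

text \<open>Differencing commutes with differentiation, so differences of iterated antiderivatives
  again form a chain of derivatives.\<close>

lemma has_derivative_forward_diff_iter:
  assumes "\<And>x. (F has_real_derivative f x) (at x)"
  shows "((forward_diff h ^^ k) F has_real_derivative (forward_diff h ^^ k) f x) (at x)"
proof (induction k arbitrary: x)
  case (Suc k)
  show ?case
    unfolding funpow.simps comp_def forward_diff_def[of h "(forward_diff h ^^ k) _"]
    by (intro DERIV_diff DERIV_shift[THEN iffD1] Suc.IH)
qed (simp add: assms)

lemma continuous_forward_diff_iter:
  assumes "continuous_on UNIV f"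
  shows "continuous_on UNIV ((forward_diff h ^^ k) f)"
proof (induction k)
  case (Suc k)
  show ?case
    unfolding funpow.simps comp_def forward_diff_def[of h "(forward_diff h ^^ k) _"]
    by (intro continuous_intros continuous_on_compose2[OF Suc.IH] Suc.IH) auto
qed (simp add: assms)

lemma ridge_approximable_monomial:
  assumes "bounded K" and cont: "continuous_on UNIV \<sigma>"
    and nonpoly: "\<not> (\<exists>q :: real poly. \<forall>x. \<sigma> x = poly q x)"
  shows "ridge_approximable \<sigma> K (\<lambda>x. x ^ k)"
proof -
  \<comment> \<open>The contrapositive of Frechet's theorem: some \<open>k\<close>-th difference of
    a non-polynomial \<open>\<sigma>\<close> is nonzero.\<close>
  obtain h \<zeta> where "h > 0" and nz: "(forward_diff h ^^ k) \<sigma> \<zeta> \<noteq> 0"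
    using frechet_polynomial[OF cont] nonpoly by metis
  obtain G where G: "G 0 = \<sigma>" "\<And>n x. (G (Suc n) has_real_derivative G n x) (at x)"
    "\<And>n. continuous_on UNIV (G n)"
    using iterated_antiderivatives[OF cont] by metis
  \<comment> \<open>The \<open>n\<close>-th difference of \<open>G (Suc n)\<close> is an
    antiderivative of the \<open>n\<close>-th difference of \<open>G n\<close>, so one further
    difference stays approximable.\<close>
  have approx: "ridge_approximable \<sigma> K ((forward_diff h ^^ n) (G n))" for n
  proof (induction n)
    case 0
    show ?case using ridge_approximable_activation by (simp add: G(1))
  next
    case (Suc n)
    show ?case
      using ridge_approximable_forward_diff[OF \<open>bounded K\<close> Suc.IH
          continuous_forward_diff_iter[OF G(3)] has_derivative_forward_diff_iter[OF G(2)] \<open>h > 0\<close>]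
      by simp
  qed
  \<comment> \<open>The order of the difference stays \<open>k\<close> while the antiderivative
    drops: \<open>f 0\<close> is approximable, \<open>f i\<close> is its \<open>i\<close>-th
    derivative, and \<open>f k\<close> is the difference of \<open>\<sigma>\<close> that is nonzero
    at \<open>\<zeta>\<close>.\<close>
  define f where "f i = (forward_diff h ^^ k) (G (k - i))" for i
  have "ridge_approximable \<sigma> K (\<lambda>x. f k \<zeta> * x ^ k)"
  proof (rule ridge_approximable_taylor_term[where f = f and k = k, OF \<open>bounded K\<close>])
    show "ridge_approximable \<sigma> K (f 0)"
      using approx by (simp add: f_def)
    show "(f i has_real_derivative f (Suc i) x) (at x)" if "i < k" for i x
    proof -
      have "k - i = Suc (k - Suc i)" using that by simp
      then show ?thesis
        unfolding f_def by (metis G(2) has_derivative_forward_diff_iter)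
    qed
    show "continuous_on UNIV (f k)"
      unfolding f_def by (intro continuous_forward_diff_iter G)
  qed simp
  then have "ridge_approximable \<sigma> K (\<lambda>x. (1 / f k \<zeta>) * (f k \<zeta> * x ^ k))"
    by (rule ridge_approximable_cmult)
  moreover have "f k \<zeta> \<noteq> 0"
    using nz by (simp add: f_def G(1))
  ultimately show ?thesis by simp
qed

text \<open>Weierstrass' theorem on \<open>[- R, R]\<close> passes from monomials to continuous
  functions; the case used below is \<open>exp\<close>.\<close>

lemma ridge_approximable_continuous:
  assumes "bounded K" "continuous_on UNIV \<sigma>" "\<not> (\<exists>q :: real poly. \<forall>x. \<sigma> x = poly q x)"
    and cont: "continuous_on UNIV f"
  shows "ridge_approximable \<sigma> K f"
proof (rule ridge_approximable_limit[OF \<open>bounded K\<close>])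
  fix R \<epsilon> :: real assume "R > 0" "\<epsilon> > 0"
  obtain g where "real_polynomial_function g" and g: "\<And>x. x \<in> {- R..R} \<Longrightarrow> \<bar>f x - g x\<bar> < \<epsilon>"
    using Stone_Weierstrass_real_polynomial_function[of "{- R..R}" f \<epsilon>] \<open>\<epsilon> > 0\<close>
      continuous_on_subset[OF cont] by (metis compact_Icc subset_UNIV)
  then obtain a n where "g = (\<lambda>x. \<Sum>i\<le>n. a i * x ^ i)"
    by (auto simp: real_polynomial_function_iff_sum)
  then have "ridge_approximable \<sigma> K g"
    using ridge_approximable_monomial[OF assms(1-3)]
    by (auto intro!: ridge_approximable_sum[OF ridge_approximable_activation]
        ridge_approximable_cmult)
  with g show "\<exists>g. ridge_approximable \<sigma> K g \<and> (\<forall>x. \<bar>x\<bar> \<le> R \<longrightarrow> \<bar>f x - g x\<bar> < \<epsilon>)"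
    by (intro exI[of _ g]) (auto simp: abs_le_iff)
qed

section \<open>The algebra of exponentials and Stone-Weierstrass\<close>

inductive exp_span :: "('a::real_inner \<Rightarrow> real) \<Rightarrow> bool" where
  scaled_exp: "exp_span (\<lambda>y. c * exp (w \<bullet> y))"
| add: "exp_span f \<Longrightarrow> exp_span g \<Longrightarrow> exp_span (\<lambda>y. f y + g y)"

text \<open>A product of two exponentials is the exponential with the summed weights, and products
  distribute over sums.\<close>

lemma exp_span_mult:
  assumes "exp_span f" "exp_span g"
  shows "exp_span (\<lambda>y. f y * g y)"
  using assms
proof (induction f)
  case (scaled_exp c w)
  then show ?case
  proof (induction g)
    case (scaled_exp d v)
    have "(\<lambda>y. c * exp (w \<bullet> y) * (d * exp (v \<bullet> y))) = (\<lambda>y. (c * d) * exp ((w + v) \<bullet> y))"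
      by (simp add: inner_add_left exp_add mult_ac)
    then show ?case
      using exp_span.scaled_exp by metis
  next
    case (add f g)
    then show ?case
      using exp_span.add by (simp add: distrib_left)
  qed
next
  case (add f g)
  then show ?case
    using exp_span.add by (simp add: distrib_right)
qed

lemma approximable_exp_span:
  assumes "ridge_approximable \<sigma> K exp" "exp_span f"
  shows "approximable \<sigma> K f"
  using assms(2)
proof induction
  case (scaled_exp c w)
  have "approximable \<sigma> K (\<lambda>y. exp (w \<bullet> y + 0))"
    using assms(1) unfolding ridge_approximable_def by blast
  then show ?case
    using approximable_cmult by auto
qed (rule approximable_add)

lemma approximable_continuous:
  fixes K :: "'a::real_inner set"
  assumes "continuous_on UNIV \<sigma>" "\<not> (\<exists>q :: real poly. \<forall>x. \<sigma> x = poly q x)"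
    and "compact K" "continuous_on K f"
  shows "approximable \<sigma> K f"
proof (rule approximable_limit)
  fix \<epsilon> :: real assume "\<epsilon> > 0"
  have "ridge_approximable \<sigma> K exp"
    using assms by (intro ridge_approximable_continuous compact_imp_bounded continuous_intros)
  moreover have "\<exists>g. exp_span g \<and> (\<forall>y\<in>K. \<bar>f y - g y\<bar> < \<epsilon>)"
  proof (rule Stone_Weierstrass_HOL[OF \<open>compact K\<close>])
    show "exp_span (\<lambda>y. c)" for c
      using exp_span.scaled_exp[of c 0] by simp
    show "continuous_on K g" if "exp_span g" for g
      using that by induction (auto intro!: continuous_intros)
    show "\<exists>g. exp_span g \<and> g x \<noteq> g y" if "x \<in> K \<and> y \<in> K \<and> x \<noteq> y" for x y
    proof (intro exI conjI)
      \<comment> \<open>With weight \<open>x - y\<close> the exponents at \<open>x\<close> and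
        \<open>y\<close> differ by the squared norm of \<open>x - y\<close>.\<close>
      show "exp_span (\<lambda>z. 1 * exp ((x - y) \<bullet> z))"
        by (rule exp_span.scaled_exp)
      have "(x - y) \<bullet> (x - y) \<noteq> 0" using that by simp
      then show "1 * exp ((x - y) \<bullet> x) \<noteq> 1 * exp ((x - y) \<bullet> y)"
        by (simp add: inner_diff_right)
    qed
  qed (auto intro: exp_span.add exp_span_mult assms \<open>\<epsilon> > 0\<close>)
  ultimately show "\<exists>g. approximable \<sigma> K g \<and> (\<forall>y\<in>K. \<bar>f y - g y\<bar> < \<epsilon>)"
    using approximable_exp_span by blast
qed

section \<open>Common weights and biases for all \<open>N\<close> functions\<close>

theorem corollary2p1:
  fixes \<sigma> :: "real \<Rightarrow> real"
    and K :: "(real ^ 'd) set"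
    and N :: nat
    and u :: "nat \<Rightarrow> real ^ 'd \<Rightarrow> real"
  assumes "continuous_on UNIV \<sigma>"
    and "\<not> (\<exists>q :: real poly. \<forall>x. \<sigma> x = poly q x)"
    and "compact K"
    and "\<forall>n\<in>{1..N}. continuous_on K (u n)"
  shows "\<forall>\<epsilon>>0. \<exists>(p :: nat) (\<zeta> :: nat \<Rightarrow> real) (w :: nat \<Rightarrow> real ^ 'd) (\<beta> :: nat \<Rightarrow> nat \<Rightarrow> real).
           p \<ge> 1 \<and>
           (\<forall>n\<in>{1..N}. \<forall>y\<in>K. \<bar>u n y - (\<Sum>i=1..p. \<beta> n i * \<sigma> (w i \<bullet> y + \<zeta> i))\<bar> < \<epsilon>)"
proof (intro allI impI)
  fix \<epsilon> :: real assume "\<epsilon> > 0"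
  have "\<forall>n\<in>{1..N}. \<exists>S \<beta>. finite S \<and> (\<forall>y\<in>K. \<bar>u n y - net \<sigma> S \<beta> y\<bar> < \<epsilon>)"
    using approximable_continuous[OF assms(1-3)] assms(4) \<open>\<epsilon> > 0\<close>
    unfolding approximable_def by blast
  then obtain S \<beta> where S: "\<And>n. n \<in> {1..N} \<Longrightarrow> finite (S n)"
    and \<beta>: "\<And>n y. n \<in> {1..N} \<Longrightarrow> y \<in> K \<Longrightarrow> \<bar>u n y - net \<sigma> (S n) (\<beta> n) y\<bar> < \<epsilon>"
    by metis
  \<comment> \<open>The extra point \<open>(0, 0)\<close> only ensures \<open>p \<ge> 1\<close>.\<close>
  define T where "T = insert (0, 0) (\<Union>n\<in>{1..N}. S n)"
  have "finite T" using S by (simp add: T_def)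
  then obtain e where e: "bij_betw e {1..card T} T"
    using ex_bij_betw_nat_finite_1 by blast
  \<comment> \<open>All functions share the neurons in \<open>T\<close>; those outside
    \<open>S n\<close> get coefficient 0, so only the coefficients depend on
    \<open>n\<close>.\<close>
  define \<gamma> where "\<gamma> n a = (if a \<in> S n then \<beta> n a else 0)" for n a
  have "(\<Sum>i=1..card T. \<gamma> n (e i) * \<sigma> (fst (e i) \<bullet> y + snd (e i))) = net \<sigma> (S n) (\<beta> n) y"
    if "n \<in> {1..N}" for n y
  proof -
    have "(\<Sum>i=1..card T. \<gamma> n (e i) * \<sigma> (fst (e i) \<bullet> y + snd (e i))) = net \<sigma> T (\<gamma> n) y"
      unfolding net_def by (rule sum.reindex_bij_betw[OF e])
    also have "\<dots> = net \<sigma> (S n) (\<beta> n) y"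
      unfolding \<gamma>_def using \<open>finite T\<close> that by (intro net_extend) (auto simp: T_def)
    finally show ?thesis .
  qed
  moreover have "card T \<ge> 1"
    using \<open>finite T\<close> by (simp add: T_def Suc_le_eq card_gt_0_iff)
  ultimately show "\<exists>(p :: nat) (\<zeta> :: nat \<Rightarrow> real) (w :: nat \<Rightarrow> real ^ 'd) (\<beta> :: nat \<Rightarrow> nat \<Rightarrow> real).
      p \<ge> 1 \<and> (\<forall>n\<in>{1..N}. \<forall>y\<in>K. \<bar>u n y - (\<Sum>i=1..p. \<beta> n i * \<sigma> (w i \<bullet> y + \<zeta> i))\<bar> < \<epsilon>)"
    using \<beta> by (intro exI[of _ "card T"] exI[of _ "\<lambda>i. snd (e i)"] exI[of _ "\<lambda>i. fst (e i)"]
        exI[of _ "\<lambda>n i. \<gamma> n (e i)"]) simp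
qed

end
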